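(* The following hold. (1) There are Hausdorff H-closed spaces of arbitrarily high Lindelöf number, i.e. for every cardinal $\lambda$ there is a Hausdorff H-closed space $X$ with $L(X)\ge\lambda$. (2) There is a Hausdorff non-compact first countable space satisfying $\mathsf{U}_{fin}(\mathcal{O},\Delta)$. (3) There is a first countable Lindelöf H-closed Hausdorff space which does not satisfy $\mathsf{U}_{fin}(\mathcal{O},\mathcal{O})$.
   Context: A cover always means a cover by open sets. A Hausdorff space is H-closed if every cover has a finite subfamily whose union is dense. The Lindelöf number $L(X)$ is the smallest cardinal $\kappa$ such that every cover of $X$ has a subcover of cardinality $\le\kappa$; a space is Lindelöf if every cover has a countable subcover, and compact if every cover has a finite subcover. $\mathcal{O}$ is the collection of all covers of the space under consideration, and $\Delta$ is the collection of its od-covers, i.e. covers all of whose members are (open and) dense. For collections $\mathcal{A},\mathcal{B}$ of covers of $X$, $X$ satisfies $\mathsf{U}_{fin}(\mathcal{A},\mathcal{B})$ if for each sequence $\langle\mathcal{U}_n : n\in\omega\rangle$ of members of $\mathcal{A}$, none of which has a finite subcover, there are finite $\mathcal{F}_n\subset\mathcal{U}_n$ such that $\{\bigcup\mathcal{F}_n : n\in\omega\}\in\mathcal{B}$. *)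

theory Defs
  imports "HOL-Analysis.Analysis"
begin

unbundle cardinal_syntax

definition open_covers :: "'a topology \<Rightarrow> 'a set set set" where
  "open_covers X = {\<U>. (\<forall>U\<in>\<U>. openin X U) \<and> \<Union>\<U> = topspace X}"

definition dense_in_space :: "'a topology \<Rightarrow> 'a set \<Rightarrow> bool" where
  "dense_in_space X S \<longleftrightarrow> X closure_of S = topspace X"

definition od_covers :: "'a topology \<Rightarrow> 'a set set set" where
  "od_covers X = {\<U> \<in> open_covers X. \<forall>U\<in>\<U>. dense_in_space X U}"

definition H_closed_space :: "'a topology \<Rightarrow> bool" where
  "H_closed_space X \<longleftrightarrow>
     Hausdorff_space X \<and>
     (\<forall>\<U>\<in>open_covers X. \<exists>\<F>. finite \<F> \<and> \<F> \<subseteq> \<U> \<and> dense_in_space X (\<Union>\<F>))"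

definition U_fin :: "'a topology \<Rightarrow> 'a set set set \<Rightarrow> 'a set set set \<Rightarrow> bool" where
  "U_fin X \<A> \<B> \<longleftrightarrow>
     (\<forall>\<U> :: nat \<Rightarrow> 'a set set.
        (\<forall>n. \<U> n \<in> \<A> \<and> \<not> (\<exists>\<F>. finite \<F> \<and> \<F> \<subseteq> \<U> n \<and> \<Union>\<F> = topspace X)) \<longrightarrow>
        (\<exists>\<F>. (\<forall>n. finite (\<F> n) \<and> \<F> n \<subseteq> \<U> n) \<and> range (\<lambda>n. \<Union>(\<F> n)) \<in> \<B>))"

text \<open>
  A cardinal is a relation \<open>r\<close> with \<open>Card_order r\<close>; cardinals are determined up to \<open>=o\<close>.
  Since no space has Lindelof number above the cardinality of its point set, the least cardinal
  can be sought among those living on the type of points; the lemmas below show that it exists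
  and that it is least among the cardinals on any type. It is not rounded up
  to \<open>\<aleph>\<^sub>0\<close>, so it may be finite.
\<close>

definition Lindelof_bound :: "'a topology \<Rightarrow> 'b rel \<Rightarrow> bool" where
  "Lindelof_bound X r \<longleftrightarrow>
     (\<forall>\<U>\<in>open_covers X. \<exists>\<V>\<subseteq>\<U>. \<V> \<in> open_covers X \<and> |\<V>| \<le>o r)"

definition Lindelof_number :: "'a topology \<Rightarrow> 'a rel" where
  "Lindelof_number X =
     (SOME r :: 'a rel. Card_order r \<and> Lindelof_bound X r \<and>
        (\<forall>r' :: 'a rel. Card_order r' \<and> Lindelof_bound X r' \<longrightarrow> r \<le>o r'))"

lemma Lindelof_bound_card_topspace: "Lindelof_bound X |topspace X|"
  unfolding Lindelof_bound_def
proof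
  fix \<U> assume U: "\<U> \<in> open_covers X"
  then have "\<forall>x\<in>topspace X. \<exists>U\<in>\<U>. x \<in> U"
    by (auto simp: open_covers_def)
  then obtain f where f: "\<And>x. x \<in> topspace X \<Longrightarrow> f x \<in> \<U> \<and> x \<in> f x"
    by metis
  then have "f ` topspace X \<subseteq> \<U>" "f ` topspace X \<in> open_covers X"
    using U openin_subset by (fastforce simp: open_covers_def)+
  then show "\<exists>\<V>\<subseteq>\<U>. \<V> \<in> open_covers X \<and> |\<V>| \<le>o |topspace X|"
    using card_of_image[of f "topspace X"] by (intro exI[of _ "f ` topspace X"]) simp
qed

lemma
  fixes X :: "'a topology"
  shows Card_order_Lindelof_number: "Card_order (Lindelof_number X)"
    and Lindelof_bound_Lindelof_number: "Lindelof_bound X (Lindelof_number X)"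
    and Lindelof_number_least_same_type:
      "\<And>r' :: 'a rel. Card_order r' \<Longrightarrow> Lindelof_bound X r' \<Longrightarrow> Lindelof_number X \<le>o r'"
proof -
  let ?R = "{r :: 'a rel. Card_order r \<and> Lindelof_bound X r}"
  have "?R \<noteq> {}"
    using Lindelof_bound_card_topspace[of X] card_of_Card_order[of "topspace X"] by fast
  then obtain r where "r \<in> ?R" "\<forall>r'\<in>?R. r \<le>o r'"
    using exists_minim_Card_order[of ?R] by (metis (no_types, lifting) mem_Collect_eq subsetI)
  then have "\<exists>r :: 'a rel. Card_order r \<and> Lindelof_bound X r \<and>
      (\<forall>r' :: 'a rel. Card_order r' \<and> Lindelof_bound X r' \<longrightarrow> r \<le>o r')"
    by auto
  from someI_ex[OF this]
  have *: "Card_order (Lindelof_number X) \<and> Lindelof_bound X (Lindelof_number X) \<and>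
      (\<forall>r' :: 'a rel. Card_order r' \<and> Lindelof_bound X r' \<longrightarrow> Lindelof_number X \<le>o r')"
    unfolding Lindelof_number_def .
  then show "Card_order (Lindelof_number X)" "Lindelof_bound X (Lindelof_number X)"
    by simp_all
  fix r' :: "'a rel" assume "Card_order r'" "Lindelof_bound X r'"
  then show "Lindelof_number X \<le>o r'"
    using * by simp
qed

lemma Lindelof_number_least:
  fixes X :: "'a topology" and r :: "'b rel"
  assumes r: "Card_order r" and bound: "Lindelof_bound X r"
  shows "Lindelof_number X \<le>o r"
proof (rule ccontr)
  assume "\<not> Lindelof_number X \<le>o r"
  then have "r <o Lindelof_number X"
    using not_ordLeq_iff_ordLess[of r "Lindelof_number X"] Card_order_Lindelof_number[of X] r
    by (simp add: card_order_on_well_order_on)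
  then have "|Field r| \<le>o |Field (Lindelof_number X)|"
    by (rule card_of_mono2[OF ordLess_imp_ordLeq])
  then obtain f where f: "inj_on f (Field r)" "f ` Field r \<subseteq> Field (Lindelof_number X)"
    using card_of_ordLeq[of "Field r" "Field (Lindelof_number X)"] by auto
  have "|Field r| =o |f ` Field r|"
    by (rule card_of_ordIsoI[OF inj_on_imp_bij_betw[OF f(1)]])
  then have eq: "r =o |f ` Field r|"
    using ordIso_transitive[OF ordIso_symmetric[OF card_of_Field_ordIso[OF r]]] by simp
  then have "Lindelof_bound X |f ` Field r|"
    using bound unfolding Lindelof_bound_def by (auto dest!: bspec intro: ordLeq_ordIso_trans[OF _ eq])
  then have "Lindelof_number X \<le>o |f ` Field r|"
    by (rule Lindelof_number_least_same_type[OF card_of_Card_order])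
  then have "Lindelof_number X \<le>o r"
    by (rule ordLeq_ordIso_trans[OF _ ordIso_symmetric[OF eq]])
  with \<open>\<not> Lindelof_number X \<le>o r\<close> show False ..
qed

text \<open>
  Existence of a space has to be stated over a fixed type of points. For a first countable
  Hausdorff space that is H-closed or satisfies \<open>U_fin X (open_covers X) (od_covers X)\<close>, the type
  \<^typ>\<open>real\<close> loses no generality: the latter property implies the former (apply it to a constant
  sequence), and a first countable H-closed Hausdorff space has at most continuum many points.
\<close>

end

theory Submission
  imports Defs
begin

text \<open>
  Given a dense set \<open>D\<close> in a compact Hausdorff space, refine the topology by shrinking neighbourhoods
  \<open>V\<close> of some of the points \<open>x\<close> to \<open>V \<inter> (D \<union> {x})\<close>. Since \<open>D\<close> stays dense, the shrunk neighbourhood is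
  dense in \<open>V\<close>, so the space stays H-closed, while the complement of \<open>D\<close> becomes a closed set that
  need not be compact. For (1) and (2) the compact space is the one-point compactification of the
  disjoint union of copies of \<open>\<omega> + 1\<close> indexed by \<open>'l\<close>, \<open>D\<close> is the set of its finite ordinals, and all
  neighbourhoods are shrunk; the points \<open>\<omega>\<close> then form a closed discrete set of size \<open>|'l|\<close>.
  A countable H-closed space satisfies \<open>U_fin\<close> from the covers to the od-covers, since a finite family
  with dense union may be enlarged to contain the \<open>n\<close>-th point. For (3) the compact space is the Cantor
  space of all sets of naturals, \<open>D\<close> consists of the finite sets, and the neighbourhoods of the points
  of \<open>D\<close> are shrunk; the infinite sets form a closed copy of the irrationals, where an infinite set can
  be chosen whose \<open>n\<close>-th element escapes the \<open>n\<close>-th finite selection for every \<open>n\<close>.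
\<close>

section \<open>General facts\<close>

lemma dense_in_spaceI:
  assumes "\<And>W. openin X W \<Longrightarrow> W \<noteq> {} \<Longrightarrow> W \<inter> S \<noteq> {}"
  shows "dense_in_space X S"
  unfolding dense_in_space_def
proof
  show "topspace X \<subseteq> X closure_of S"
    unfolding in_closure_of subset_iff using assms by blast
qed (rule closure_of_subset_topspace)

text \<open>Removing all of \<open>C\<close> except one point \<open>x\<close> leaves an open set,
  the only member of the cover that contains \<open>x\<close>; so a subcover must keep all of these.
  The complement of \<open>C\<close> is adjoined for the case that \<open>C\<close> is
  empty.\<close>

lemma closed_discrete_cover:
  assumes "\<And>A. A \<subseteq> C \<Longrightarrow> closedin X A"
  obtains \<U> where "\<U> \<in> open_covers X"
    "\<And>\<V>. \<V> \<subseteq> \<U> \<Longrightarrow> \<Union>\<V> = topspace X \<Longrightarrow> |C| \<le>o |\<V>|"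
proof
  let ?U = "\<lambda>x. topspace X - (C - {x})"
  let ?\<U> = "insert (topspace X - C) (?U ` C)"
  have C: "C \<subseteq> topspace X"
    using assms[of C] closedin_subset by blast
  have "openin X (topspace X - A)" if "A \<subseteq> C" for A
    using assms[OF that] by blast
  then show "?\<U> \<in> open_covers X"
    using C by (auto simp: open_covers_def)
  show "|C| \<le>o |\<V>|" if V: "\<V> \<subseteq> ?\<U>" "\<Union>\<V> = topspace X" for \<V>
  proof -
    have "?U ` C \<subseteq> \<V>"
    proof clarify
      fix x assume x: "x \<in> C"
      then obtain V where "V \<in> \<V>" "x \<in> V"
        using V(2) C by blast
      moreover have "V = ?U x"
        using calculation V(1) x by auto
      ultimately show "?U x \<in> \<V>" by simp
    qed
    moreover have "inj_on ?U C"
      using C by (auto simp: inj_on_def set_eq_iff) 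
    ultimately show "|C| \<le>o |\<V>|"
      using card_of_ordLeq by blast
  qed
qed

lemma closed_discrete_le_Lindelof_number:
  assumes "\<And>A. A \<subseteq> C \<Longrightarrow> closedin X A"
  shows "|C| \<le>o Lindelof_number X"
proof -
  obtain \<U> where U: "\<U> \<in> open_covers X"
    "\<And>\<V>. \<V> \<subseteq> \<U> \<Longrightarrow> \<Union>\<V> = topspace X \<Longrightarrow> |C| \<le>o |\<V>|"
    by (rule closed_discrete_cover[where C = C, OF assms]) (assumption, rule that)
  then obtain \<V> where "\<V> \<subseteq> \<U>" "\<V> \<in> open_covers X" "|\<V>| \<le>o Lindelof_number X"
    using Lindelof_bound_Lindelof_number[of X] unfolding Lindelof_bound_def by blast
  then show ?thesis
    using U(2)[of \<V>] ordLeq_transitive by (auto simp: open_covers_def)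
qed

lemma not_compact_if_infinite_closed_discrete:
  assumes "\<And>A. A \<subseteq> C \<Longrightarrow> closedin X A" and "infinite C"
  shows "\<not> compact_space X"
proof
  assume "compact_space X"
  obtain \<U> where U: "\<U> \<in> open_covers X"
    "\<And>\<V>. \<V> \<subseteq> \<U> \<Longrightarrow> \<Union>\<V> = topspace X \<Longrightarrow> |C| \<le>o |\<V>|"
    by (rule closed_discrete_cover[where C = C, OF assms(1)]) (assumption, rule that)
  from U(1) have op: "\<forall>U\<in>\<U>. openin X U" and "\<Union>\<U> = topspace X"
    by (simp_all add: open_covers_def)
  then have "\<exists>\<V>. finite \<V> \<and> \<V> \<subseteq> \<U> \<and> topspace X \<subseteq> \<Union>\<V>"
    using \<open>compact_space X\<close> by (simp add: compact_space_alt)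
  then obtain \<V> where V: "finite \<V>" "\<V> \<subseteq> \<U>" "topspace X \<subseteq> \<Union>\<V>"
    by blast
  have "\<Union>\<V> \<subseteq> topspace X"
    using V(2) op openin_subset by blast
  with V(3) have "\<Union>\<V> = topspace X"
    by (rule equalityI[rotated])
  then have "|C| \<le>o |\<V>|"
    by (rule U(2)[OF V(2)])
  then show False
    using V(1) assms(2) card_of_ordLeq_finite by blast
qed

lemma U_finE:
  fixes \<U> :: "nat \<Rightarrow> 'a set set"
  assumes "U_fin X \<A> \<B>" and "\<And>n. \<U> n \<in> \<A>"
    and "\<And>n \<F>. finite \<F> \<Longrightarrow> \<F> \<subseteq> \<U> n \<Longrightarrow> \<Union>\<F> \<noteq> topspace X"
  obtains \<F> where "\<And>n. finite (\<F> n)" "\<And>n. \<F> n \<subseteq> \<U> n" "range (\<lambda>n. \<Union>(\<F> n)) \<in> \<B>"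
proof -
  have "\<exists>\<F>. (\<forall>n. finite (\<F> n) \<and> \<F> n \<subseteq> \<U> n) \<and> range (\<lambda>n. \<Union>(\<F> n)) \<in> \<B>"
    by (rule assms(1)[unfolded U_fin_def, THEN spec, THEN mp]) (use assms(2,3) in simp)
  then obtain \<F> where "\<forall>n. finite (\<F> n) \<and> \<F> n \<subseteq> \<U> n" "range (\<lambda>n. \<Union>(\<F> n)) \<in> \<B>"
    by blast
  then show thesis
    by (intro that[of \<F>]) simp_all
qed

lemma countable_H_closed_imp_U_fin:
  assumes X: "H_closed_space X" and "countable (topspace X)"
  shows "U_fin X (open_covers X) (od_covers X)"
  unfolding U_fin_def
proof (intro allI impI)
  fix \<U> :: "nat \<Rightarrow> 'a set set"
  assume *: "\<forall>n. \<U> n \<in> open_covers X \<and> \<not> (\<exists>\<F>. finite \<F> \<and> \<F> \<subseteq> \<U> n \<and> \<Union>\<F> = topspace X)"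
  then have U: "\<And>n. \<U> n \<in> open_covers X" by blast
  \<comment> \<open>On the empty space the empty family would be a finite subcover. Nonemptiness
    lets \<open>from_nat_into\<close> enumerate exactly the points.\<close>
  have ne: "topspace X \<noteq> {}"
    using * by (metis Union_empty empty_subsetI finite.emptyI)
  define e where "e = from_nat_into (topspace X)"
  have e: "range e = topspace X"
    unfolding e_def using range_from_nat_into[OF ne assms(2)] .
  have "\<exists>\<F>. finite \<F> \<and> \<F> \<subseteq> \<U> n \<and> dense_in_space X (\<Union>\<F>) \<and> e n \<in> \<Union>\<F>" for n
  proof -
    obtain \<F> where F: "finite \<F>" "\<F> \<subseteq> \<U> n" "dense_in_space X (\<Union>\<F>)"
      using X U[of n] unfolding H_closed_space_def by blast
    have "e n \<in> topspace X" using e by blast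
    then obtain V where V: "V \<in> \<U> n" "e n \<in> V"
      using U[of n] unfolding open_covers_def by blast
    have "X closure_of \<Union>\<F> \<subseteq> X closure_of \<Union>(insert V \<F>)"
      by (rule closure_of_mono) auto
    then have "dense_in_space X (\<Union>(insert V \<F>))"
      using F(3) closure_of_subset_topspace unfolding dense_in_space_def by fastforce
    then show ?thesis
      using F V by (intro exI[of _ "insert V \<F>"]) auto
  qed
  then obtain \<F> where F: "\<And>n. finite (\<F> n)" "\<And>n. \<F> n \<subseteq> \<U> n"
    "\<And>n. dense_in_space X (\<Union>(\<F> n))" "\<And>n. e n \<in> \<Union>(\<F> n)"
    by metis
  have op: "openin X (\<Union>(\<F> n))" for n
    using F(2) U[of n] unfolding open_covers_def by blast
  have "(\<Union>n. \<Union>(\<F> n)) = topspace X"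
  proof
    show "(\<Union>n. \<Union>(\<F> n)) \<subseteq> topspace X"
      using op openin_subset by blast
    show "topspace X \<subseteq> (\<Union>n. \<Union>(\<F> n))"
      unfolding e[symmetric] using F(4) by blast
  qed
  then have "range (\<lambda>n. \<Union>(\<F> n)) \<in> od_covers X"
    using op F(3) unfolding od_covers_def open_covers_def by auto
  then show "\<exists>\<F>. (\<forall>n. finite (\<F> n) \<and> \<F> n \<subseteq> \<U> n) \<and> range (\<lambda>n. \<Union>(\<F> n)) \<in> od_covers X"
    using F by blast
qed

section \<open>Transport along homeomorphisms\<close>

text \<open>The theorem prescribes the types of points, so each space is built on a convenient type
  and then moved by an injection. On \<open>range j\<close> the map \<open>inv j\<close> is a true
  inverse of \<open>j\<close>; pulling back along it gives the copy.\<close>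

lemma inj_imp_homeomorphic_copy:
  fixes X :: "'a topology" and j :: "'a \<Rightarrow> 'b"
  assumes "inj j"
  obtains Y where "homeomorphic_map X Y j"
proof -
  let ?Y = "pullback_topology (range j) (inv j) X"
  have "continuous_map X ?Y j"
    by (rule continuous_map_pullback') (use assms in \<open>auto simp: o_def\<close>)
  moreover have "continuous_map ?Y X (inv j)"
    using continuous_map_pullback[of X X id "range j" "inv j"] by (simp add: o_def)
  ultimately have "homeomorphic_maps X ?Y j (inv j)"
    unfolding homeomorphic_maps_def topspace_pullback_topology using assms by auto
  then show thesis
    using that homeomorphic_map_maps by blast
qed

lemma homeomorphic_image_open_covers:
  assumes "homeomorphic_map X Y f" "\<U> \<in> open_covers X"
  shows "(`) f ` \<U> \<in> open_covers Y"
proof -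
  have "openin Y (f ` U)" if "U \<in> \<U>" for U
    using that assms homeomorphic_imp_open_map[OF assms(1)]
    unfolding open_covers_def open_map_def by blast
  moreover have "\<Union>((`) f ` \<U>) = topspace Y"
    using assms homeomorphic_imp_surjective_map[OF assms(1)]
    unfolding open_covers_def image_Union[symmetric] by simp
  ultimately show ?thesis
    unfolding open_covers_def by blast
qed

text \<open>The inverse \<open>g\<close> carries a cover of \<open>Y\<close> to one of
  \<open>X\<close>. The finite family found there is the image of a finite subfamily of the given
  cover, and \<open>f\<close> commutes with closures, so density returns to
  \<open>Y\<close>.\<close>

lemma homeomorphic_H_closed_space:
  assumes f: "homeomorphic_map X Y f" and X: "H_closed_space X"
  shows "H_closed_space Y"
  unfolding H_closed_space_def
proof (intro conjI ballI)
  show "Hausdorff_space Y"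
    using X homeomorphic_Hausdorff_space[OF homeomorphic_map_imp_homeomorphic_space[OF f]]
    unfolding H_closed_space_def by blast
  fix \<U> assume U: "\<U> \<in> open_covers Y"
  obtain g where fg: "homeomorphic_maps X Y f g"
    using f homeomorphic_map_maps by blast
  then have g: "homeomorphic_map Y X g" and inv: "\<And>y. y \<in> topspace Y \<Longrightarrow> f (g y) = y"
    by (auto simp: homeomorphic_maps_map)
  obtain \<G> where G: "finite \<G>" "\<G> \<subseteq> (`) g ` \<U>" "dense_in_space X (\<Union>\<G>)"
    using X homeomorphic_image_open_covers[OF g U] unfolding H_closed_space_def by blast
  then obtain \<F> where F: "finite \<F>" "\<F> \<subseteq> \<U>" "\<G> = (`) g ` \<F>"
    by (meson finite_subset_image)
  have sub: "\<Union>\<F> \<subseteq> topspace Y"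
    using F(2) U unfolding open_covers_def by blast
  then have sub': "g ` \<Union>\<F> \<subseteq> topspace X"
    using homeomorphic_imp_surjective_map[OF g] by blast
  have "(\<lambda>y. f (g y)) ` \<Union>\<F> = (\<lambda>y. y) ` \<Union>\<F>"
    by (rule image_cong[OF refl]) (rule inv[OF subsetD[OF sub]])
  then have "f ` g ` \<Union>\<F> = \<Union>\<F>"
    by (simp only: image_image image_ident)
  moreover have "X closure_of (g ` \<Union>\<F>) = topspace X"
    using G(3) F(3) unfolding dense_in_space_def image_Union by simp
  ultimately have "dense_in_space Y (\<Union>\<F>)"
    using homeomorphic_map_closure_of[OF f sub'] homeomorphic_imp_surjective_map[OF f]
    unfolding dense_in_space_def by simp
  then show "\<exists>\<F>. finite \<F> \<and> \<F> \<subseteq> \<U> \<and> dense_in_space Y (\<Union>\<F>)"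
    using F by blast
qed

text \<open>Directed from codomain to domain because it is applied in contrapositive form, to a copy
  \<open>Y\<close> of a space \<open>X\<close> that lacks the property.\<close>

lemma homeomorphic_U_fin_open_covers:
  assumes f: "homeomorphic_map X Y f" and Y: "U_fin Y (open_covers Y) (open_covers Y)"
  shows "U_fin X (open_covers X) (open_covers X)"
  unfolding U_fin_def
proof (intro allI impI)
  fix \<U> :: "nat \<Rightarrow> 'a set set"
  assume *: "\<forall>n. \<U> n \<in> open_covers X \<and> \<not> (\<exists>\<F>. finite \<F> \<and> \<F> \<subseteq> \<U> n \<and> \<Union>\<F> = topspace X)"
  then have U: "\<And>n. \<U> n \<in> open_covers X"
    and nofin: "\<And>n \<F>. finite \<F> \<Longrightarrow> \<F> \<subseteq> \<U> n \<Longrightarrow> \<Union>\<F> \<noteq> topspace X"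
    by simp_all
  have surj: "f ` topspace X = topspace Y" and inj: "inj_on f (topspace X)"
    using f homeomorphic_imp_surjective_map homeomorphic_imp_injective_map by blast+
  have sub: "\<Union>\<F> \<subseteq> topspace X" if "\<F> \<subseteq> \<U> n" for \<F> n
    using U[of n] that unfolding open_covers_def by blast
  \<comment> \<open>\<open>U_fin\<close> only answers covers without finite subcovers, so their
    absence is transported too: \<open>f\<close>, being injective, cancels from an equality of
    images.\<close>
  have nofin': "\<Union>\<G> \<noteq> topspace Y" if G: "finite \<G>" "\<G> \<subseteq> (`) f ` \<U> n" for n \<G>
  proof
    assume Y: "\<Union>\<G> = topspace Y"
    obtain \<F> where F: "finite \<F>" "\<F> \<subseteq> \<U> n" "\<G> = (`) f ` \<F>"
      using finite_subset_image[OF G] by blast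
    then have "f ` \<Union>\<F> = f ` topspace X"
      using surj Y by (simp add: image_Union)
    then have "\<Union>\<F> = topspace X"
      using inj_on_image_eq_iff[OF inj sub[OF F(2)] subset_refl] by blast
    then show False using nofin F by blast
  qed
  obtain \<G> where G: "\<And>n. finite (\<G> n)" "\<And>n. \<G> n \<subseteq> (`) f ` \<U> n"
    "range (\<lambda>n. \<Union>(\<G> n)) \<in> open_covers Y"
    by (rule U_finE[OF Y homeomorphic_image_open_covers[OF f U] nofin']) (assumption, assumption, rule that)
  have "\<exists>\<F>. finite \<F> \<and> \<F> \<subseteq> \<U> n \<and> \<G> n = (`) f ` \<F>" for n
    using finite_subset_image[OF G(1,2)[of n]] by blast
  then obtain \<F> where F: "\<And>n. finite (\<F> n)" "\<And>n. \<F> n \<subseteq> \<U> n" "\<And>n. \<G> n = (`) f ` \<F> n"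
    by metis
  have op: "openin X (\<Union>(\<F> n))" for n
    using F(2)[of n] U[of n] unfolding open_covers_def by blast
  have sub_all: "(\<Union>n. \<Union>(\<F> n)) \<subseteq> topspace X"
    using sub[OF F(2)] by blast
  have "f ` (\<Union>n. \<Union>(\<F> n)) = f ` topspace X"
    using G(3) F(3) surj unfolding open_covers_def by (simp add: image_Union image_UN)
  then have "(\<Union>n. \<Union>(\<F> n)) = topspace X"
    using inj_on_image_eq_iff[OF inj sub_all subset_refl] by blast
  then have "range (\<lambda>n. \<Union>(\<F> n)) \<in> open_covers X"
    using op unfolding open_covers_def by auto
  then show "\<exists>\<F>. (\<forall>n. finite (\<F> n) \<and> \<F> n \<subseteq> \<U> n) \<and> range (\<lambda>n. \<Union>(\<F> n)) \<in> open_covers X"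
    using F by blast
qed

section \<open>The fan\<close>

text \<open>
  \<open>Leaf l n\<close> and \<open>Spine l\<close> are the points \<open>n\<close> and \<open>\<omega>\<close> of the \<open>l\<close>-th copy of \<open>\<omega> + 1\<close>, and \<open>Apex\<close> is the
  point at infinity (isolated if \<open>'l\<close> is finite).
\<close>

datatype 'l fan = Leaf 'l nat | Spine 'l | Apex

instance fan :: (countable) countable
  by countable_datatype

text \<open>Leaves are isolated. A neighbourhood of \<open>Apex\<close> has to contain the leaves of
  almost all copies but none of their spine points: this is where the one-point compactification is
  refined.\<close>

definition fan_open :: "'l fan set \<Rightarrow> bool" where
  "fan_open W \<longleftrightarrow>
     (\<forall>l. Spine l \<in> W \<longrightarrow> finite {n. Leaf l n \<notin> W}) \<and>
     (Apex \<in> W \<longrightarrow> finite {l. \<exists>n. Leaf l n \<notin> W})"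

definition fan_topology :: "'l fan topology" where
  "fan_topology = topology fan_open"

lemma openin_fan_topology: "openin fan_topology W \<longleftrightarrow> fan_open (W :: 'l fan set)"
proof -
  have "istopology (fan_open :: 'l fan set \<Rightarrow> bool)"
    unfolding istopology_def
  proof (intro conjI allI impI)
    fix S T :: "'l fan set" assume "fan_open S" "fan_open T"
    moreover have "{n. Leaf l n \<notin> S \<inter> T} = {n. Leaf l n \<notin> S} \<union> {n. Leaf l n \<notin> T}" for l
      by auto
    moreover have "{l. \<exists>n. Leaf l n \<notin> S \<inter> T} = {l. \<exists>n. Leaf l n \<notin> S} \<union> {l. \<exists>n. Leaf l n \<notin> T}"
      by auto
    ultimately show "fan_open (S \<inter> T)"
      unfolding fan_open_def by simp
  next
    fix \<K> :: "'l fan set set" assume K: "\<forall>K\<in>\<K>. fan_open K"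
    have "finite {n. Leaf l n \<notin> \<Union>\<K>}" if "K \<in> \<K>" "Spine l \<in> K" for l K
      by (rule finite_subset[of _ "{n. Leaf l n \<notin> K}"])
        (use that K in \<open>auto simp: fan_open_def\<close>)
    moreover have "finite {l. \<exists>n. Leaf l n \<notin> \<Union>\<K>}" if "K \<in> \<K>" "Apex \<in> K" for K
      by (rule finite_subset[of _ "{l. \<exists>n. Leaf l n \<notin> K}"])
        (use that K in \<open>auto simp: fan_open_def\<close>)
    ultimately show "fan_open (\<Union>\<K>)"
      unfolding fan_open_def by blast
  qed
  then show ?thesis
    unfolding fan_topology_def by simp
qed

lemma topspace_fan_topology [simp]: "topspace fan_topology = UNIV"
proof -
  have "openin fan_topology UNIV"
    by (simp add: openin_fan_topology fan_open_def)
  then show ?thesis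
    using openin_subset by blast
qed

text \<open>The complement contains every leaf, so both exceptional sets in \<open>fan_open\<close>
  are empty. Thus the spine points form a closed discrete set.\<close>

lemma closedin_fan_Spine:
  assumes "A \<subseteq> range Spine"
  shows "closedin fan_topology A"
proof -
  have "Leaf l n \<notin> A" for l n
    using assms by blast
  then show ?thesis
    by (simp add: closedin_def openin_fan_topology fan_open_def)
qed

lemma Hausdorff_fan_topology: "Hausdorff_space fan_topology"
  unfolding Hausdorff_space_def
proof (intro allI impI, elim conjE)
  let ?N = "\<lambda>l. insert (Spine l) (range (Leaf l))"
  \<comment> \<open>Separation as a symmetric relation, so that the nine pairs of constructors
    reduce to three cases.\<close>
  define sep :: "'l fan \<Rightarrow> 'l fan \<Rightarrow> bool" where
    "sep x y \<longleftrightarrow> (\<exists>U V. fan_open U \<and> fan_open V \<and> x \<in> U \<and> y \<in> V \<and> disjnt U V)" for x y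
  have sym: "sep y x" if "sep x y" for x y
    using that disjnt_sym unfolding sep_def by blast
  have sepI: "sep x y" if "fan_open U" "fan_open V" "x \<in> U" "y \<in> V" "disjnt U V"
    for U V x y
    using that unfolding sep_def by blast
  have leaf: "sep (Leaf l n) y" if "y \<noteq> Leaf l n" for l n and y :: "'l fan"
  proof (rule sepI[of "{Leaf l n}" "- {Leaf l n}"])
    have "finite {m. Leaf k m \<notin> - {Leaf l n}}" for k
      by (rule finite_subset[of _ "{n}"]) auto
    moreover have "finite {k. \<exists>m. Leaf k m \<notin> - {Leaf l n}}"
      by (rule finite_subset[of _ "{l}"]) auto
    ultimately show "fan_open (- {Leaf l n})"
      unfolding fan_open_def by blast
  qed (use that in \<open>auto simp: fan_open_def disjnt_def\<close>)
  have N: "fan_open (?N l)" for l :: 'l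
    by (auto simp: fan_open_def)
  have spine: "sep (Spine l) (Spine k)" if "l \<noteq> k" for l k :: 'l
    using that by (intro sepI[OF N[of l] N[of k]]) (auto simp: disjnt_def)
  \<comment> \<open>The neighbourhood of \<open>Apex\<close> omits the leaves of the one copy
    \<open>l\<close>, and all spine points.\<close>
  have apex: "sep (Spine l) Apex" for l :: 'l
  proof (rule sepI[OF N[of l], of "insert Apex {Leaf k n |k n. k \<noteq> l}"])
    have "finite {k. \<exists>n. Leaf k n \<notin> insert Apex {Leaf k n |k n. k \<noteq> l}}"
      by (rule finite_subset[of _ "{l}"]) auto
    then show "fan_open (insert Apex {Leaf k n |k n. k \<noteq> l})"
      unfolding fan_open_def by auto
  qed (auto simp: disjnt_def)
  fix x y :: "'l fan" assume "x \<noteq> y"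
  then have "sep x y"
    using leaf spine apex by (cases x; cases y) (auto intro: sym)
  then show "\<exists>U V. openin fan_topology U \<and> openin fan_topology V \<and> x \<in> U \<and> y \<in> V \<and> disjnt U V"
    by (simp add: openin_fan_topology sep_def)
qed

lemma H_closed_fan_topology: "H_closed_space (fan_topology :: 'l fan topology)"
  unfolding H_closed_space_def
proof (intro conjI ballI Hausdorff_fan_topology)
  fix \<U> :: "'l fan set set" assume "\<U> \<in> open_covers fan_topology"
  then have op: "\<And>U. U \<in> \<U> \<Longrightarrow> fan_open U" and cov: "\<And>x. \<exists>U\<in>\<U>. x \<in> U"
    by (auto simp: open_covers_def openin_fan_topology set_eq_iff)
  obtain u where u: "\<And>x. u x \<in> \<U>" "\<And>x. x \<in> u x"
    using cov by metis
  \<comment> \<open>\<open>u Apex\<close> misses leaves in the finitely many copies \<open>L\<close>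
    only, and \<open>u (Spine l)\<close> misses only the finitely many leaves \<open>M l\<close> of
    its copy. Hence the neighbourhoods chosen at the finite set \<open>P\<close> contain every
    leaf.\<close>
  define L where "L = {l. \<exists>n. Leaf l n \<notin> u Apex}"
  define M where "M l = {n. Leaf l n \<notin> u (Spine l)}" for l
  define P where "P = insert Apex (Spine ` L \<union> (\<Union>l\<in>L. Leaf l ` M l))"
  have "finite L" "\<And>l. finite (M l)"
    using op[OF u(1)] u(2) unfolding L_def M_def fan_open_def by blast+
  then have fin: "finite (u ` P)" by (simp add: P_def)
  have leaf: "Leaf l n \<in> \<Union>(u ` P)" for l n
  proof (cases "l \<in> L")
    case True
    show ?thesis
    proof (cases "n \<in> M l")
      case True
      then have "Leaf l n \<in> P" using \<open>l \<in> L\<close> by (auto simp: P_def)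
      then show ?thesis using u(2) by blast
    next
      case False
      then show ?thesis using \<open>l \<in> L\<close> by (auto simp: P_def M_def)
    qed
  next
    case False
    then show ?thesis by (auto simp: P_def L_def)
  qed
  have "dense_in_space fan_topology (\<Union>(u ` P))"
  proof (rule dense_in_spaceI)
    fix W :: "'l fan set" assume W: "openin fan_topology W" "W \<noteq> {}"
    show "W \<inter> \<Union>(u ` P) \<noteq> {}"
    \<comment> \<open>A separate case, since for finite \<open>'l\<close> the set
      \<open>{Apex}\<close> is open and contains no leaf.\<close>
    proof (cases "Apex \<in> W")
      case True
      then show ?thesis using u(2)[of Apex] by (auto simp: P_def)
    next
      case False
      then obtain l n where "Leaf l n \<in> W"
      proof -
        obtain x where x: "x \<in> W" using W(2) by blast
        show thesis
        proof (cases x)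
          case (Spine l)
          then have "finite {n. Leaf l n \<notin> W}"
            using W(1) x by (auto simp: openin_fan_topology fan_open_def)
          then have "{n. Leaf l n \<notin> W} \<noteq> UNIV"
            using infinite_UNIV_nat by metis
          then show thesis using that by blast
        qed (use x False that in auto)
      qed
      then show ?thesis using leaf by blast
    qed
  qed
  then show "\<exists>\<F>. finite \<F> \<and> \<F> \<subseteq> \<U> \<and> dense_in_space fan_topology (\<Union>\<F>)"
    using fin u(1) by (intro exI[of _ "u ` P"]) auto
qed

text \<open>With \<open>nat\<close> as index type, a finite exceptional set lies below some
  \<open>N\<close>, so the tails from \<open>N\<close> on give countable bases at the spine points
  and at \<open>Apex\<close>.\<close>

lemma second_countable_fan_topology: "second_countable (fan_topology :: nat fan topology)"
proof -
  let ?S = "\<lambda>l N. insert (Spine l) (Leaf l ` {N..})"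
  let ?A = "\<lambda>N. insert Apex {Leaf l n |l n. l \<ge> N}"
  define \<B> :: "nat fan set set" where "\<B> = range (\<lambda>(l, n). {Leaf l n}) \<union> range (\<lambda>(l, N). ?S l N) \<union> range ?A"
  have leaf: "fan_open {Leaf l n}" for l n :: nat
    by (simp add: fan_open_def)
  have S: "fan_open (?S l N)" for l N :: nat
  proof -
    have "finite {n. Leaf l n \<notin> ?S l N}"
      by (rule finite_subset[of _ "{..<N}"]) auto
    then show ?thesis by (auto simp: fan_open_def)
  qed
  have A: "fan_open (?A N)" for N :: nat
  proof -
    have "finite {l. \<exists>n. Leaf l n \<notin> ?A N}"
      by (rule finite_subset[of _ "{..<N}"]) auto
    then show ?thesis by (auto simp: fan_open_def)
  qed
  have "\<exists>V\<in>\<B>. x \<in> V \<and> V \<subseteq> U" if U: "fan_open U" "x \<in> U" for U and x :: "nat fan"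
  proof (cases x)
    case (Leaf l n)
    have "{Leaf l n} \<in> \<B>"
      unfolding \<B>_def by (intro UnI1 image_eqI[of _ _ "(l, n)"]) simp_all
    then show ?thesis using U Leaf by (intro bexI[of _ "{Leaf l n}"]) simp_all
  next
    case (Spine l)
    then have "finite {n. Leaf l n \<notin> U}"
      using U by (auto simp: fan_open_def)
    then obtain N where "{n. Leaf l n \<notin> U} \<subseteq> {..<N}"
      using finite_nat_bounded by blast
    then have "?S l N \<subseteq> U"
      using U Spine by force
    moreover have "?S l N \<in> \<B>"
      unfolding \<B>_def by (intro UnI1 UnI2 image_eqI[of _ _ "(l, N)"]) simp_all
    ultimately show ?thesis using Spine by (intro bexI[of _ "?S l N"]) simp_all
  next
    case Apex
    then have "finite {l. \<exists>n. Leaf l n \<notin> U}"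
      using U by (auto simp: fan_open_def)
    then obtain N where "{l. \<exists>n. Leaf l n \<notin> U} \<subseteq> {..<N}"
      using finite_nat_bounded by blast
    then have "?A N \<subseteq> U"
      using U Apex by force
    moreover have "?A N \<in> \<B>"
      unfolding \<B>_def by (rule UnI2) (rule rangeI)
    ultimately show ?thesis using Apex by (intro bexI[of _ "?A N"]) simp_all
  qed
  moreover have "\<forall>V\<in>\<B>. fan_open V"
    unfolding \<B>_def by (intro ballI, elim UnE rangeE) (simp_all only: split_beta leaf S A)
  moreover have "countable \<B>" by (simp add: \<B>_def)
  ultimately show ?thesis
    unfolding second_countable_def openin_fan_topology by blast
qed

section \<open>The refined Cantor space\<close>

text \<open>The basic clopen sets of the Cantor space, a set of naturals standing for its
  characteristic function.\<close>

definition cyl :: "nat \<Rightarrow> nat set \<Rightarrow> nat set set" where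
  "cyl n A = {B. \<forall>k<n. k \<in> B \<longleftrightarrow> k \<in> A}"

lemma cyl_refl [simp]: "A \<in> cyl n A"
  by (simp add: cyl_def)

lemma cyl_antimono: "m \<le> n \<Longrightarrow> cyl n A \<subseteq> cyl m A"
  by (auto simp: cyl_def)

lemma cyl_eq: "B \<in> cyl n A \<Longrightarrow> cyl n B = cyl n A"
  by (simp add: cyl_def)

text \<open>The guard \<open>finite A \<longrightarrow> finite B\<close> shrinks a cylinder to its
  finite members when its centre is finite and leaves it whole when the centre is infinite. Finite
  \<open>B\<close> always pass it.\<close>

definition cantor_open :: "nat set set \<Rightarrow> bool" where
  "cantor_open W \<longleftrightarrow> (\<forall>A\<in>W. \<exists>n. \<forall>B\<in>cyl n A. (finite A \<longrightarrow> finite B) \<longrightarrow> B \<in> W)"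

definition refined_cantor :: "nat set topology" where
  "refined_cantor = topology cantor_open"

lemma openin_refined_cantor: "openin refined_cantor W \<longleftrightarrow> cantor_open W"
proof -
  have "istopology cantor_open"
    unfolding istopology_def
  proof (intro conjI allI impI)
    fix S T assume "cantor_open S" "cantor_open T"
    show "cantor_open (S \<inter> T)"
      unfolding cantor_open_def
    proof
      fix A assume "A \<in> S \<inter> T"
      then obtain m n where "\<forall>B\<in>cyl m A. (finite A \<longrightarrow> finite B) \<longrightarrow> B \<in> S"
        "\<forall>B\<in>cyl n A. (finite A \<longrightarrow> finite B) \<longrightarrow> B \<in> T"
        using \<open>cantor_open S\<close> \<open>cantor_open T\<close> unfolding cantor_open_def by blast
      then show "\<exists>n. \<forall>B\<in>cyl n A. (finite A \<longrightarrow> finite B) \<longrightarrow> B \<in> S \<inter> T"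
        using cyl_antimono[of m "max m n" A] cyl_antimono[of n "max m n" A]
        by (intro exI[of _ "max m n"]) auto
    qed
  next
    fix \<K> assume "\<forall>K\<in>\<K>. cantor_open K"
    then show "cantor_open (\<Union>\<K>)"
      unfolding cantor_open_def by (meson UnionE UnionI)
  qed
  then show ?thesis
    unfolding refined_cantor_def by simp
qed

lemma topspace_refined_cantor [simp]: "topspace refined_cantor = UNIV"
proof -
  have "openin refined_cantor UNIV"
    by (simp add: openin_refined_cantor cantor_open_def)
  then show ?thesis
    using openin_subset by blast
qed

lemma cantor_open_cyl: "cantor_open (cyl n A)"
  unfolding cantor_open_def
proof (intro ballI exI[of _ n] impI)
  fix B C assume "B \<in> cyl n A" "C \<in> cyl n B"
  then show "C \<in> cyl n A"
    using cyl_eq[of B n A] by simp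
qed

lemma cantor_open_finite_cyl: "cantor_open (cyl n A \<inter> {B. finite B})"
  unfolding cantor_open_def
proof (intro ballI exI[of _ n] impI)
  fix B C assume "B \<in> cyl n A \<inter> {B. finite B}" "C \<in> cyl n B" "finite B \<longrightarrow> finite C"
  then show "C \<in> cyl n A \<inter> {B. finite B}"
    using cyl_eq[of B n A] by simp
qed

lemma Hausdorff_refined_cantor: "Hausdorff_space refined_cantor"
  unfolding Hausdorff_space_def openin_refined_cantor
proof (intro allI impI, elim conjE)
  fix A B :: "nat set" assume "A \<noteq> B"
  then obtain n where "n \<in> A \<longleftrightarrow> n \<notin> B" by blast
  then have "disjnt (cyl (Suc n) A) (cyl (Suc n) B)"
    by (auto simp: disjnt_def cyl_def)
  then show "\<exists>U V. cantor_open U \<and> cantor_open V \<and> A \<in> U \<and> B \<in> V \<and> disjnt U V"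
    using cantor_open_cyl by (meson cyl_refl)
qed

lemma second_countable_refined_cantor: "second_countable refined_cantor"
proof -
  \<comment> \<open>Truncating a centre below \<open>n\<close> does not change its cylinder of
    length \<open>n\<close>, so finite centres suffice, and there are countably many.\<close>
  let ?I = "UNIV \<times> {F :: nat set. finite F}"
  define \<B> where "\<B> = (\<lambda>(n, F). cyl n F) ` ?I \<union> (\<lambda>(n, F). cyl n F \<inter> {B. finite B}) ` ?I"
  have "countable {F :: nat set. finite F}"
    by (rule countable_Collect_finite)
  then have "countable \<B>" by (simp add: \<B>_def)
  moreover have "\<forall>V\<in>\<B>. cantor_open V"
    using cantor_open_cyl cantor_open_finite_cyl by (auto simp: \<B>_def)
  moreover have "\<exists>V\<in>\<B>. A \<in> V \<and> V \<subseteq> U" if U: "cantor_open U" "A \<in> U" for U A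
  proof -
    obtain n where n: "\<forall>B\<in>cyl n A. (finite A \<longrightarrow> finite B) \<longrightarrow> B \<in> U"
      using U unfolding cantor_open_def by blast
    have "A \<inter> {..<n} \<in> cyl n A" by (auto simp: cyl_def)
    then have eq: "cyl n (A \<inter> {..<n}) = cyl n A" by (rule cyl_eq)
    have I: "(n, A \<inter> {..<n}) \<in> ?I" by simp
    show ?thesis
    proof (cases "finite A")
      case True
      have "cyl n A \<inter> {B. finite B} \<in> \<B>"
        using imageI[OF I, of "\<lambda>(n, F). cyl n F \<inter> {B. finite B}"] eq by (simp add: \<B>_def)
      then show ?thesis using n True by (intro bexI[of _ "cyl n A \<inter> {B. finite B}"]) auto
    next
      case False
      have "cyl n A \<in> \<B>"
        using imageI[OF I, of "\<lambda>(n, F). cyl n F"] eq by (simp add: \<B>_def)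
      then show ?thesis using n False by (intro bexI[of _ "cyl n A"]) auto
    qed
  qed
  ultimately show ?thesis
    unfolding second_countable_def openin_refined_cantor by blast
qed

text \<open>The finite sets are dense, so it suffices to cover them by finitely many members. This
  is Koenig's argument: otherwise repeated halving gives nested cylinders whose finite sets are not
  finitely covered, but a member containing the limit point covers all finite sets in one of
  them.\<close>

lemma H_closed_refined_cantor: "H_closed_space refined_cantor"
  unfolding H_closed_space_def
proof (intro conjI ballI Hausdorff_refined_cantor)
  fix \<U> assume "\<U> \<in> open_covers refined_cantor"
  then have op: "\<And>U. U \<in> \<U> \<Longrightarrow> cantor_open U" and cov: "\<And>A. \<exists>U\<in>\<U>. A \<in> U"
    by (auto simp: open_covers_def openin_refined_cantor set_eq_iff)
  define good where
    "good n A \<longleftrightarrow> (\<exists>\<F>. finite \<F> \<and> \<F> \<subseteq> \<U> \<and> cyl n A \<inter> {B. finite B} \<subseteq> \<Union>\<F>)" for n A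
  \<comment> \<open>A cylinder of length \<open>n\<close> splits in two by deciding whether
    \<open>n\<close> belongs; if both halves were good, so would be the whole.\<close>
  have step: "\<exists>A'. \<not> good (Suc n) A' \<and> A' \<in> cyl n A" if "\<not> good n A" for n A
  proof (rule ccontr)
    assume "\<nexists>A'. \<not> good (Suc n) A' \<and> A' \<in> cyl n A"
    moreover have "A - {n} \<in> cyl n A" "insert n A \<in> cyl n A"
      by (auto simp: cyl_def)
    ultimately have "good (Suc n) (A - {n})" "good (Suc n) (insert n A)" by blast+
    then obtain \<F> \<G> where "finite \<F>" "\<F> \<subseteq> \<U>" "cyl (Suc n) (A - {n}) \<inter> {B. finite B} \<subseteq> \<Union>\<F>"
      "finite \<G>" "\<G> \<subseteq> \<U>" "cyl (Suc n) (insert n A) \<inter> {B. finite B} \<subseteq> \<Union>\<G>"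
      unfolding good_def by blast
    moreover have "cyl n A \<subseteq> cyl (Suc n) (A - {n}) \<union> cyl (Suc n) (insert n A)"
      by (auto simp: cyl_def less_Suc_eq)
    ultimately have "good n A"
      unfolding good_def by (intro exI[of _ "\<F> \<union> \<G>"]) auto
    then show False using that by blast
  qed
  have "good 0 {}"
  proof (rule ccontr)
    assume "\<not> good 0 {}"
    then obtain f where f: "\<And>n. \<not> good n (f n)" "\<And>n. f (Suc n) \<in> cyl n (f n)"
      using dependent_nat_choice[of "\<lambda>n A. \<not> good n A" "\<lambda>n A A'. A' \<in> cyl n A"] step by metis
    \<comment> \<open>The limit of the branch: membership of \<open>n\<close> is settled from stage
      \<open>Suc n\<close> on.\<close>
    define A where "A = {n. n \<in> f (Suc n)}"
    have f_mem: "f m \<in> cyl n (f n)" if "n \<le> m" for m n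
      using that
    proof (induction m rule: dec_induct)
      case (step m)
      then show ?case
        using cyl_antimono[of n m "f m"] cyl_eq[of "f m" n "f n"] f(2)[of m] by blast
    qed simp
    have A: "A \<in> cyl n (f n)" for n
    proof -
      have "k \<in> A \<longleftrightarrow> k \<in> f n" if "k < n" for k
        using f_mem[of "Suc k" n] that by (auto simp: A_def cyl_def)
      then show ?thesis by (auto simp: cyl_def)
    qed
    obtain U where U: "U \<in> \<U>" "A \<in> U" using cov by blast
    then obtain n where "\<forall>B\<in>cyl n A. (finite A \<longrightarrow> finite B) \<longrightarrow> B \<in> U"
      using op unfolding cantor_open_def by blast
    \<comment> \<open>Finite \<open>B\<close> satisfy the guard whether or not \<open>A\<close> is
      finite, so \<open>U\<close> alone covers the finite sets of this cylinder.\<close>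
    then have "good n (f n)"
      unfolding good_def using U(1) cyl_eq[OF A[of n]] by (intro exI[of _ "{U}"]) auto
    then show False using f(1) by blast
  qed
  then obtain \<F> where F: "finite \<F>" "\<F> \<subseteq> \<U>" "{B. finite B} \<subseteq> \<Union>\<F>"
    unfolding good_def by (auto simp: cyl_def)
  have "dense_in_space refined_cantor (\<Union>\<F>)"
  proof (rule dense_in_spaceI)
    fix W assume "openin refined_cantor W" "W \<noteq> {}"
    then obtain A n where "\<forall>B\<in>cyl n A. (finite A \<longrightarrow> finite B) \<longrightarrow> B \<in> W"
      unfolding openin_refined_cantor cantor_open_def by blast
    moreover have "A \<inter> {..<n} \<in> cyl n A" by (auto simp: cyl_def)
    ultimately have "A \<inter> {..<n} \<in> W" by auto
    moreover have "A \<inter> {..<n} \<in> \<Union>\<F>" using F(3) by auto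
    ultimately show "W \<inter> \<Union>\<F> \<noteq> {}" by blast
  qed
  then show "\<exists>\<F>. finite \<F> \<and> \<F> \<subseteq> \<U> \<and> dense_in_space refined_cantor (\<Union>\<F>)"
    using F by blast
qed

text \<open>The sets whose \<open>n\<close>-th element, counted from 0, is \<open>k\<close>. Phrased
  by counting below \<open>k\<close>, membership depends only on the part of \<open>A\<close> up to
  \<open>k\<close>, which makes it open.\<close>

definition nth_is :: "nat \<Rightarrow> nat \<Rightarrow> nat set set" where
  "nth_is n k = {A. k \<in> A \<and> card (A \<inter> {..<k}) = n}"

text \<open>The elements of \<open>range s\<close> below \<open>s i\<close> are the values at
  \<open>0, ..., i - 1\<close>, exactly \<open>i\<close> of them.\<close>

lemma range_in_nth_is:
  assumes s: "strict_mono s"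
  shows "range s \<in> nth_is n k \<longleftrightarrow> k = s n"
proof -
  have "range s \<inter> {..<s i} = s ` {..<i}" for i
    using strict_mono_less[OF s] by auto
  then have "card (range s \<inter> {..<s i}) = i" for i
    using card_image[of s "{..<i}"] strict_mono_imp_inj_on[OF s] by simp
  then show ?thesis
    unfolding nth_is_def by auto
qed

lemma cantor_open_nth_is: "cantor_open (nth_is n k)"
  unfolding cantor_open_def
proof
  fix A assume A: "A \<in> nth_is n k"
  \<comment> \<open>Length \<open>Suc k\<close>, not \<open>k\<close>, so that membership of
    \<open>k\<close> itself is fixed.\<close>
  have "B \<in> nth_is n k" if "B \<in> cyl (Suc k) A" for B
  proof -
    have "B \<inter> {..<k} = A \<inter> {..<k}" "k \<in> B \<longleftrightarrow> k \<in> A"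
      using that by (auto simp: cyl_def less_Suc_eq)
    then show ?thesis using A by (simp add: nth_is_def)
  qed
  then show "\<exists>n'. \<forall>B\<in>cyl n' A. (finite A \<longrightarrow> finite B) \<longrightarrow> B \<in> nth_is n k"
    by blast
qed

lemma not_U_fin_refined_cantor:
  "\<not> U_fin refined_cantor (open_covers refined_cantor) (open_covers refined_cantor)"
proof
  assume U_fin: "U_fin refined_cantor (open_covers refined_cantor) (open_covers refined_cantor)"
  define \<U> where "\<U> n = insert {A. finite A} (range (nth_is n))" for n
  have cov: "\<U> n \<in> open_covers refined_cantor" for n
  proof -
    have "cantor_open {A. finite A}"
      using cantor_open_finite_cyl[of 0 "{}"] by (simp add: cyl_def)
    have "A \<in> \<Union>(\<U> n)" for A
      using range_in_nth_is[OF strict_mono_enumerate, of A n "enumerate A n"] range_enumerate[of A]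
      by (cases "finite A") (auto simp: \<U>_def)
    then have "\<Union>(\<U> n) = UNIV"
      by blast
    moreover have "\<forall>U\<in>\<U> n. cantor_open U"
      using \<open>cantor_open {A. finite A}\<close> cantor_open_nth_is by (auto simp: \<U>_def)
    ultimately show ?thesis
      by (simp add: open_covers_def openin_refined_cantor)
  qed
  have escape: "\<exists>A. \<forall>n. A \<notin> \<Union>(\<F> n)" if F: "\<And>n. finite (\<F> n)" "\<And>n. \<F> n \<subseteq> \<U> n" for \<F>
  proof -
    \<comment> \<open>Finitely many members leave only boundedly many values for the
      \<open>n\<close>-th element of an infinite set.\<close>
    have "\<exists>m. \<F> n \<subseteq> insert {A. finite A} (nth_is n ` {..<m})" for n
    proof -
      have "finite (\<F> n - {{A. finite A}})" "\<F> n - {{A. finite A}} \<subseteq> range (nth_is n)"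
        using F[of n] by (auto simp: \<U>_def)
      then obtain K where K: "finite K" "\<F> n - {{A. finite A}} = nth_is n ` K"
        by (metis finite_subset_image)
      obtain m where "K \<subseteq> {..<m}"
        using finite_nat_bounded[OF K(1)] by blast
      then have "\<F> n - {{A. finite A}} \<subseteq> nth_is n ` {..<m}"
        unfolding K(2) by (rule image_mono)
      then show ?thesis
        unfolding Diff_subset_conv insert_is_Un[symmetric] by (rule exI)
    qed
    then obtain m where m: "\<And>n. \<F> n \<subseteq> insert {A. finite A} (nth_is n ` {..<m n})"
      by metis
    \<comment> \<open>The sum makes \<open>s n\<close> at least \<open>m n\<close>, and the summand
      \<open>n\<close> makes \<open>s\<close> strictly increasing, so that \<open>s n\<close> is the
      \<open>n\<close>-th element of \<open>range s\<close>.\<close>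
    define s where "s n = n + (\<Sum>i\<le>n. m i)" for n
    have s: "strict_mono s"
      by (rule strict_monoI_Suc) (simp add: s_def)
    then have inf: "infinite (range s)"
      using strict_mono_imp_inj_on range_inj_infinite by blast
    have "m n \<le> s n" for n
      unfolding s_def by (rule trans_le_add2) (simp add: member_le_sum)
    have "range s \<notin> \<Union>(\<F> n)" for n
    proof
      assume "range s \<in> \<Union>(\<F> n)"
      then obtain k where "k < m n" "range s \<in> nth_is n k"
        using m[of n] inf by blast
      then show False
        using \<open>m n \<le> s n\<close> range_in_nth_is[OF s] by simp
    qed
    then show ?thesis by blast
  qed
  have nofin: "\<Union>\<F> \<noteq> topspace refined_cantor" if "finite \<F>" "\<F> \<subseteq> \<U> n" for n \<F>
  proof
    assume "\<Union>\<F> = topspace refined_cantor"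
    moreover have "\<exists>A. \<forall>k. A \<notin> \<Union>(if k = n then \<F> else {})"
      \<comment> \<open>A single finite family is treated as a selection that is empty at all other
        indices; so no \<open>\<U> n\<close> has a finite subcover.\<close>
      by (rule escape) (use that in simp_all)
    then obtain A where "\<forall>k. A \<notin> \<Union>(if k = n then \<F> else {})" ..
    then have "A \<notin> \<Union>\<F>"
      by (auto dest: spec[of _ n])
    ultimately show False by simp
  qed
  obtain \<F> where F: "\<And>n. finite (\<F> n)" "\<And>n. \<F> n \<subseteq> \<U> n"
    "range (\<lambda>n. \<Union>(\<F> n)) \<in> open_covers refined_cantor"
    by (rule U_finE[OF U_fin cov nofin]) (assumption, assumption, rule that)
  then have "(\<Union>n. \<Union>(\<F> n)) = UNIV"
    by (simp add: open_covers_def)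
  moreover obtain A where "\<forall>n. A \<notin> \<Union>(\<F> n)"
    using escape[OF F(1,2)] ..
  ultimately show False
    by blast
qed

section \<open>The three spaces on the prescribed types of points\<close>

theorem proposition3p5:
  shows "(\<forall>lam :: 'l rel. Card_order lam \<longrightarrow>
            (\<exists>X :: ('l \<times> nat) set set topology.
               Hausdorff_space X \<and> H_closed_space X \<and> lam \<le>o Lindelof_number X))
       \<and> (\<exists>X :: real topology.
            Hausdorff_space X \<and> \<not> compact_space X \<and> first_countable X \<and>
            U_fin X (open_covers X) (od_covers X))
       \<and> (\<exists>X :: real topology.
            first_countable X \<and> Lindelof_space X \<and> H_closed_space X \<and> Hausdorff_space X \<and>
            \<not> U_fin X (open_covers X) (open_covers X))"
proof (intro conjI allI impI)
  fix lam :: "'l rel" assume lam: "Card_order lam"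
  \<comment> \<open>An injective coding: a leaf becomes a family with a one-point member, a spine
    point a family with an infinite fibre as member, and the apex the empty family.\<close>
  define j :: "'l fan \<Rightarrow> ('l \<times> nat) set set" where
    "j = case_fan (\<lambda>l n. {{(l, n)}}) (\<lambda>l. {range (Pair l)}) {}"
  have "{(k, n)} \<noteq> range (Pair l)" for l k :: 'l and n :: nat
  proof
    assume eq: "{(k, n)} = range (Pair l)"
    have "(l, Suc n) \<in> {(k, n)}"
      unfolding eq by (rule rangeI)
    then show False by simp
  qed
  moreover have "l = k" if "range (Pair l) = range (Pair k :: nat \<Rightarrow> _)" for l k :: 'l
    using that by blast
  ultimately have "inj j"
    unfolding j_def by (intro injI) (auto split: fan.splits dest: sym)
  then obtain X where X: "homeomorphic_map fan_topology X j"
    using inj_imp_homeomorphic_copy by blast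
  have "closedin X A" if A: "A \<subseteq> j ` range Spine" for A
  proof -
    obtain B where B: "B \<subseteq> range Spine" "A = j ` B"
      by (rule subset_imageE[OF A])
    then show ?thesis
      using closedin_fan_Spine[OF B(1)] homeomorphic_map_closedness_eq[OF X, of B] by simp
  qed
  then have "|j ` range Spine| \<le>o Lindelof_number X"
    by (rule closed_discrete_le_Lindelof_number)
  moreover have "lam \<le>o |j ` range Spine|"
  proof -
    \<comment> \<open>Every cardinal on \<open>'l\<close> is bounded by \<open>|UNIV|\<close>, the
      number of spine points, so the same fan serves all \<open>lam\<close>.\<close>
    have "lam =o |Field lam|"
      using card_of_Field_ordIso[OF lam] ordIso_symmetric by blast
    moreover have "|Field lam| \<le>o |UNIV :: 'l set|"
      by (rule card_of_mono1) (rule subset_UNIV)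
    moreover have "|UNIV :: 'l set| \<le>o |j ` range Spine|"
      unfolding image_image
      by (rule card_of_ordLeq[THEN iffD1], rule exI[of _ "\<lambda>l. j (Spine l)"])
        (use \<open>inj j\<close> in \<open>auto simp: inj_def\<close>)
    ultimately show ?thesis
      using ordIso_ordLeq_trans ordLeq_transitive by blast
  qed
  moreover have "H_closed_space X"
    using homeomorphic_H_closed_space[OF X H_closed_fan_topology] .
  ultimately show "\<exists>X :: ('l \<times> nat) set set topology.
      Hausdorff_space X \<and> H_closed_space X \<and> lam \<le>o Lindelof_number X"
    using ordLeq_transitive unfolding H_closed_space_def by blast
next
  define j :: "nat fan \<Rightarrow> real" where "j x = real (to_nat x)" for x
  have "inj j"
    by (auto simp: inj_def j_def)
  then obtain X where X: "homeomorphic_map fan_topology X j"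
    using inj_imp_homeomorphic_copy by blast
  then have hom: "(fan_topology :: nat fan topology) homeomorphic_space X"
    by (rule homeomorphic_map_imp_homeomorphic_space)
  have H: "H_closed_space X"
    using homeomorphic_H_closed_space[OF X H_closed_fan_topology] .
  have "topspace X = range j"
    using homeomorphic_imp_surjective_map[OF X] by simp
  then have "U_fin X (open_covers X) (od_covers X)"
    using countable_H_closed_imp_U_fin[OF H] by simp
  moreover have "infinite (range (Spine :: nat \<Rightarrow> nat fan))"
    by (simp add: inj_def range_inj_infinite)
  then have "\<not> compact_space X"
    using not_compact_if_infinite_closed_discrete[OF closedin_fan_Spine]
      homeomorphic_compact_space[OF hom] by blast
  moreover have "first_countable X"
    using second_countable_imp_first_countable[OF second_countable_fan_topology]
      homeomorphic_space_first_countability[OF hom] by blast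
  ultimately show "\<exists>X :: real topology. Hausdorff_space X \<and> \<not> compact_space X \<and>
      first_countable X \<and> U_fin X (open_covers X) (od_covers X)"
    using H unfolding H_closed_space_def by blast
next
  obtain j :: "nat set \<Rightarrow> real" where "inj j"
    using eqpoll_imp_lepoll[OF nat_sets_eqpoll_reals] unfolding lepoll_def by blast
  then obtain X where X: "homeomorphic_map refined_cantor X j"
    using inj_imp_homeomorphic_copy by blast
  then have hom: "refined_cantor homeomorphic_space X"
    by (rule homeomorphic_map_imp_homeomorphic_space)
  \<comment> \<open>Second countability is what is transferred, as it yields both first countability
    and the Lindelof property.\<close>
  have "second_countable X"
    using second_countable_refined_cantor homeomorphic_space_second_countability[OF hom] by blast
  moreover have "H_closed_space X"
    using homeomorphic_H_closed_space[OF X H_closed_refined_cantor] .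
  moreover have "\<not> U_fin X (open_covers X) (open_covers X)"
    using not_U_fin_refined_cantor homeomorphic_U_fin_open_covers[OF X] by blast
  ultimately show "\<exists>X :: real topology. first_countable X \<and> Lindelof_space X \<and>
      H_closed_space X \<and> Hausdorff_space X \<and> \<not> U_fin X (open_covers X) (open_covers X)"
    using second_countable_imp_first_countable second_countable_imp_Lindelof_space
    unfolding H_closed_space_def by blast
qed

end
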